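(* Let a POMDP with finite horizon $T$ be given by finite nonempty sets $\mathcal{X}_S,\mathcal{X}_O,\mathcal{X}_A$, probabilities $p(s)$, $p(o|s)$, $p(s'|s,a)$ and a reward $r:\mathcal{X}_S\times\mathcal{X}_A\times\mathcal{X}_S\to\mathbb{R}$. Let $v^*$ be the optimal value of the memoryless-policy problem $\max_{\delta\in\Delta}\mathbb{E}_\delta\big[\sum_{t=1}^T r(S_t,A_t,S_{t+1})\big]$ and let $z^*$ be the optimal value of the mixed-integer linear program (MILP) defined in the context. Let $(\mu,\delta)$ be a feasible solution of (MILP). Then $\mu$ is equal to the distribution $\mathbb{P}_\delta$ induced by $\delta$, i.e. for all $s\in\mathcal{X}_S$, $o\in\mathcal{X}_O$, $a\in\mathcal{X}_A$, $t\in[T]$, $$\mu_s^t=\mathbb{P}_\delta(S_t=s),\qquad \mu_{sa}^t=\mathbb{P}_\delta(S_t=s,A_t=a),\qquad \mu_{soa}^t=\mathbb{P}_\delta(S_t=s,O_t=o,A_t=a).$$ Moreover, $(\mu,\delta)$ is an optimal solution of (MILP) if and only if $\delta$ is an optimal deterministic policy of the memoryless-policy problem (i.e. $\delta\in\Delta^0$ and $\delta$ attains $v^*$). Furthermore, $v^*=z^*$.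
   Context: Notation: $[N]=\{1,\dots,N\}$. $\mathcal{X}_S$ is the state space, $\mathcal{X}_O$ the observation space, $\mathcal{X}_A$ the action space (all finite). $p(s)=\mathbb{P}(S_1=s)$ is the initial distribution, $p(o|s)=\mathbb{P}(O_t=o|S_t=s)$ the emission probability, $p(s'|s,a)=\mathbb{P}(S_{t+1}=s'|S_t=s,A_t=a)$ the transition probability, for all $t\in[T]$. Policies: $\Delta=\{\delta=(\delta^t_{a|o})\in\mathbb{R}^{T\times|\mathcal{X}_A|\times|\mathcal{X}_O|}:\ \sum_{a}\delta^t_{a|o}=1,\ \delta^t_{a|o}\ge 0\ \forall o,a,t\in[T]\}$; deterministic policies are $\Delta^0=\{\delta\in\Delta:\ \delta^t_{a|o}\in\{0,1\}\ \forall o,a,t\}$. For $\delta\in\Delta$, $\mathbb{P}_\delta$ (with expectation $\mathbb{E}_\delta$) is the law of $(S_t,O_t,A_t)_{t\in[T]},S_{T+1}$ given by: $S_1\sim p(\cdot)$; at each $t\in[T]$, $O_t\sim p(\cdot|S_t)$, then $A_t\sim\delta^t_{\cdot|O_t}$, then $S_{t+1}\sim p(\cdot|S_t,A_t)$. (MILP): over variables $\mu=\big((\mu_s^t)_s,(\mu_{sa}^t)_{s,a},(\mu_{soa}^t)_{s,o,a}\big)_t$ (with $\mu_s^t$ for $t\in[T+1]$ and the others for $t\in[T]$) and $\delta$, maximize $\sum_{t=1}^T\sum_{s,s'\in\mathcal{X}_S,\,a\in\mathcal{X}_A} r(s,a,s')\,p(s'|s,a)\,\mu_{sa}^t$ subject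 to, for all $s,s'\in\mathcal{X}_S$, $o\in\mathcal{X}_O$, $a\in\mathcal{X}_A$, $t\in[T]$: - $\mu_s^1=p(s)$; - $\mu_{s'}^{t+1}=\sum_{s\in\mathcal{X}_S,a\in\mathcal{X}_A}p(s'|s,a)\mu_{sa}^t$; - $\mu_{sa}^t=\sum_{o\in\mathcal{X}_O}\mu_{soa}^t$; - $\mu_{soa}^t\le p(o|s)\mu_s^t$; - $\mu_{soa}^t\le\delta^t_{a|o}$; - $\mu_{soa}^t\ge p(o|s)(\mu_s^t+\delta^t_{a|o}-1)$; - $\delta\in\Delta^0$; - $\mu\ge 0$. *)

theory Defs
  imports "HOL-Probability.Probability"
begin

record ('s, 'o, 'a) pomdp =
  horizon :: nat
  init_prob :: "'s pmf"
  emission :: "'s \<Rightarrow> 'o pmf"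
  transition :: "'s \<Rightarrow> 'a \<Rightarrow> 's pmf"
  reward :: "'s \<Rightarrow> 'a \<Rightarrow> 's \<Rightarrow> real"

text \<open>
  For a policy \<open>d\<close>, the number \<open>d t a y\<close> is the probability of action \<open>a\<close> at time \<open>t\<close> given
  observation \<open>y\<close>. Time is one-based; values at times outside \<open>{1..T}\<close> are never used.
\<close>

type_synonym ('o, 'a) policy = "nat \<Rightarrow> 'a \<Rightarrow> 'o \<Rightarrow> real"

definition policies :: "('s, 'o::finite, 'a::finite) pomdp \<Rightarrow> ('o, 'a) policy set" where
  "policies P = {d. \<forall>t\<in>{1..horizon P}. \<forall>y. (\<Sum>a\<in>UNIV. d t a y) = 1 \<and> (\<forall>a. d t a y \<ge> 0)}"

definition det_policies :: "('s, 'o::finite, 'a::finite) pomdp \<Rightarrow> ('o, 'a) policy set" where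
  "det_policies P = {d \<in> policies P. \<forall>t\<in>{1..horizon P}. \<forall>y a. d t a y \<in> {0, 1}}"

text \<open>
  A trajectory \<open>([(s\<^sub>1, y\<^sub>1, a\<^sub>1), \<dots>, (s\<^sub>n, y\<^sub>n, a\<^sub>n)], s)\<close> holds the first \<open>n\<close> steps and the state \<open>s\<close>
  at time \<open>n + 1\<close>. Whenever \<open>d \<in> policies P\<close> and \<open>t \<in> {1..T}\<close>, the argument of
  \<^const>\<open>embed_pmf\<close> below is a probability mass function.
\<close>

type_synonym ('s, 'o, 'a) trajectory = "('s \<times> 'o \<times> 'a) list \<times> 's"

primrec trajectory_pmf ::
  "('s, 'o, 'a) pomdp \<Rightarrow> ('o, 'a) policy \<Rightarrow> nat \<Rightarrow> ('s, 'o, 'a) trajectory pmf" where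
  "trajectory_pmf P d 0 = map_pmf (\<lambda>s. ([], s)) (init_prob P)"
| "trajectory_pmf P d (Suc n) =
     do {
       (h, s) \<leftarrow> trajectory_pmf P d n;
       y \<leftarrow> emission P s;
       a \<leftarrow> embed_pmf (\<lambda>a. d (Suc n) a y);
       s' \<leftarrow> transition P s a;
       return_pmf (h @ [(s, y, a)], s')
     }"

definition law :: "('s, 'o, 'a) pomdp \<Rightarrow> ('o, 'a) policy \<Rightarrow> ('s, 'o, 'a) trajectory pmf" where
  "law P d = trajectory_pmf P d (horizon P)"

definition state_at :: "nat \<Rightarrow> ('s, 'o, 'a) trajectory \<Rightarrow> 's" where
  "state_at t w = (if t \<le> length (fst w) then fst (fst w ! (t - 1)) else snd w)"

definition obs_at :: "nat \<Rightarrow> ('s, 'o, 'a) trajectory \<Rightarrow> 'o" where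
  "obs_at t w = fst (snd (fst w ! (t - 1)))"

definition action_at :: "nat \<Rightarrow> ('s, 'o, 'a) trajectory \<Rightarrow> 'a" where
  "action_at t w = snd (snd (fst w ! (t - 1)))"

definition policy_value :: "('s, 'o, 'a) pomdp \<Rightarrow> ('o, 'a) policy \<Rightarrow> real" where
  "policy_value P d = measure_pmf.expectation (law P d)
     (\<lambda>w. \<Sum>t=1..horizon P. reward P (state_at t w) (action_at t w) (state_at (t + 1) w))"

text \<open>The variables \<open>((\<mu>\<^sub>s)\<^sub>s, (\<mu>\<^sub>s\<^sub>a)\<^sub>s\<^sub>,\<^sub>a, (\<mu>\<^sub>s\<^sub>o\<^sub>a)\<^sub>s\<^sub>,\<^sub>o\<^sub>,\<^sub>a)\<close>, each indexed by time first.\<close>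

type_synonym ('s, 'o, 'a) moments =
  "(nat \<Rightarrow> 's \<Rightarrow> real) \<times> (nat \<Rightarrow> 's \<Rightarrow> 'a \<Rightarrow> real) \<times> (nat \<Rightarrow> 's \<Rightarrow> 'o \<Rightarrow> 'a \<Rightarrow> real)"

definition milp_feasible ::
  "('s::finite, 'o::finite, 'a::finite) pomdp \<Rightarrow>
    (('s, 'o, 'a) moments \<times> ('o, 'a) policy) set" where
  "milp_feasible P = {((mS, mSA, mSOA), d).
     (\<forall>s. mS 1 s = pmf (init_prob P) s) \<and>
     (\<forall>t\<in>{1..horizon P}. \<forall>s'.
        mS (t + 1) s' = (\<Sum>s\<in>UNIV. \<Sum>a\<in>UNIV. pmf (transition P s a) s' * mSA t s a)) \<and>
     (\<forall>t\<in>{1..horizon P}. \<forall>s a. mSA t s a = (\<Sum>y\<in>UNIV. mSOA t s y a)) \<and>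
     (\<forall>t\<in>{1..horizon P}. \<forall>s y a. mSOA t s y a \<le> pmf (emission P s) y * mS t s) \<and>
     (\<forall>t\<in>{1..horizon P}. \<forall>s y a. mSOA t s y a \<le> d t a y) \<and>
     (\<forall>t\<in>{1..horizon P}. \<forall>s y a.
        mSOA t s y a \<ge> pmf (emission P s) y * (mS t s + d t a y - 1)) \<and>
     d \<in> det_policies P \<and>
     (\<forall>t\<in>{1..horizon P + 1}. \<forall>s. mS t s \<ge> 0) \<and>
     (\<forall>t\<in>{1..horizon P}. \<forall>s a. mSA t s a \<ge> 0) \<and>
     (\<forall>t\<in>{1..horizon P}. \<forall>s y a. mSOA t s y a \<ge> 0)}"

definition milp_objective ::
  "('s::finite, 'o, 'a::finite) pomdp \<Rightarrow> ('s, 'o, 'a) moments \<times> ('o, 'a) policy \<Rightarrow> real" where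
  "milp_objective P = (\<lambda>((mS, mSA, mSOA), d).
     \<Sum>t=1..horizon P. \<Sum>s\<in>UNIV. \<Sum>s'\<in>UNIV. \<Sum>a\<in>UNIV.
       reward P s a s' * pmf (transition P s a) s' * mSA t s a)"

text \<open>
  Optimal values are extended reals, so that the supremum is meaningful without a separate
  argument that the problem is feasible and bounded.
\<close>

definition v_star :: "('s, 'o::finite, 'a::finite) pomdp \<Rightarrow> ereal" where
  "v_star P = (SUP d\<in>policies P. ereal (policy_value P d))"

definition z_star :: "('s::finite, 'o::finite, 'a::finite) pomdp \<Rightarrow> ereal" where
  "z_star P = (SUP x\<in>milp_feasible P. ereal (milp_objective P x))"

end

theory Submission
  imports Defs
begin

text \<open>
  Write \<open>\<pi>\<^sub>t(s)\<close> for the probability of state \<open>s\<close> at time \<open>t\<close> under a policy \<open>d\<close>. Two ideas carry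
  the proof.

  First, when \<open>\<delta> = d t a y\<close> is \<open>0\<close> or \<open>1\<close>, the linear constraints
  \<open>0 \<le> \<mu> \<le> \<delta>\<close>, \<open>\<mu> \<le> p(y|s) \<mu>\<^sub>s\<close> and \<open>\<mu> \<ge> p(y|s) (\<mu>\<^sub>s + \<delta> - 1)\<close> leave no choice but
  \<open>\<mu> = p(y|s) \<mu>\<^sub>s \<delta>\<close> (\<open>milp_feasible_joint\<close>). Together with the initial and flow constraints this is
  the forward recursion of \<open>\<pi>\<^sub>t\<close>, so a feasible \<open>\<mu>\<close> must be the family of marginals of
  the law of \<open>d\<close> (\<open>milp_feasible_unique\<close>); conversely those marginals are feasible
  (\<open>milp_feasible_induced\<close>). As the expected reward is linear in the marginals, the MILP
  objective at \<open>(\<mu>, d)\<close> is the value of \<open>d\<close> (\<open>milp_objective_eq_policy_value\<close>). Hence the MILP is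
  the problem of maximizing the value over deterministic policies.

  Second, randomization does not help. The pair \<open>(t, y)\<close> of a time and an observation is met at
  most once along a trajectory, so the action that \<open>d\<close> would draw there may as well be drawn before
  the process starts (\<open>trajectory_pmf_randomise_first\<close>). Thus the value of \<open>d\<close> is an average of
  the values of the policies in which this one draw is replaced by a constant, and one of these is
  at least as good. Treating the finitely many pairs \<open>(t, y)\<close> in turn yields a deterministic
  policy that is at least as good as \<open>d\<close> (\<open>ex_det_policy_ge\<close>). The deterministic policies have
  finitely many values, so the maximum is attained.
\<close>

section \<open>The law of a single step\<close>

text \<open>
  The law of state, observation, action and next state at time \<open>n + 1\<close>. The nested
  \<^const>\<open>Pair\<close> maps display it as a chain of conditional distributions, which makes its
  point masses products.
\<close>

definition step_pmf ::
  "('s, 'o, 'a) pomdp \<Rightarrow> ('o, 'a) policy \<Rightarrow> nat \<Rightarrow> ('s \<times> 'o \<times> 'a \<times> 's) pmf" where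
  "step_pmf P d n =
     map_pmf snd (trajectory_pmf P d n) \<bind> (\<lambda>s. map_pmf (Pair s)
       (emission P s \<bind> (\<lambda>y. map_pmf (Pair y)
         (embed_pmf (\<lambda>a. d (Suc n) a y) \<bind> (\<lambda>a. map_pmf (Pair a) (transition P s a))))))"

definition step_at :: "nat \<Rightarrow> ('s, 'o, 'a) trajectory \<Rightarrow> 's \<times> 'o \<times> 'a \<times> 's" where
  "step_at t w = (state_at t w, obs_at t w, action_at t w, state_at (t + 1) w)"

lemma length_trajectory: "w \<in> set_pmf (trajectory_pmf P d n) \<Longrightarrow> length (fst w) = n"
  by (induction n arbitrary: w) auto

lemma finite_set_trajectory_pmf:
  fixes P :: "('s::finite, 'o::finite, 'a::finite) pomdp"
  shows "finite (set_pmf (trajectory_pmf P d n))"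
proof (rule finite_subset)
  show "set_pmf (trajectory_pmf P d n) \<subseteq> {h. set h \<subseteq> UNIV \<and> length h = n} \<times> UNIV"
    using length_trajectory[of _ P d n] by auto
  show "finite ({h :: ('s \<times> 'o \<times> 'a) list. set h \<subseteq> UNIV \<and> length h = n} \<times> (UNIV :: 's set))"
    by (intro finite_cartesian_product finite_lists_length_eq) auto
qed

lemma trajectory_pmf_cong:
  assumes "\<And>t. t \<in> {1..n} \<Longrightarrow> d t = d' t"
  shows "trajectory_pmf P d n = trajectory_pmf P d' n"
  using assms by (induction n) auto

lemma map_step_at_last:
  "map_pmf (step_at (Suc n)) (trajectory_pmf P d (Suc n)) = step_pmf P d n"
proof -
  have "map_pmf (step_at (Suc n)) (trajectory_pmf P d (Suc n)) =
      trajectory_pmf P d n \<bind> (\<lambda>w. map_pmf (Pair (snd w))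
        (emission P (snd w) \<bind> (\<lambda>y. map_pmf (Pair y)
          (embed_pmf (\<lambda>a. d (Suc n) a y) \<bind>
            (\<lambda>a. map_pmf (Pair a) (transition P (snd w) a))))))"
    unfolding trajectory_pmf.simps map_bind_pmf[of _ "trajectory_pmf P d n"]
  proof (rule bind_pmf_cong[OF refl])
    fix w assume "w \<in> set_pmf (trajectory_pmf P d n)"
    moreover obtain h s where "w = (h, s)" by force
    ultimately have w: "w = (h, s)" "length h = n" using length_trajectory by fastforce+
    then have "step_at (Suc n) (h @ [(s, y, a)], s') = (s, y, a, s')" for y a s'
      by (simp add: step_at_def state_at_def obs_at_def action_at_def nth_append)
    then show "map_pmf (step_at (Suc n)) (case w of (h, s) \<Rightarrow> emission P s \<bind> (\<lambda>y.
        embed_pmf (\<lambda>a. d (Suc n) a y) \<bind> (\<lambda>a. transition P s a \<bind>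
          (\<lambda>s'. return_pmf (h @ [(s, y, a)], s'))))) =
      map_pmf (Pair (snd w))
        (emission P (snd w) \<bind> (\<lambda>y. map_pmf (Pair y)
          (embed_pmf (\<lambda>a. d (Suc n) a y) \<bind>
            (\<lambda>a. map_pmf (Pair a) (transition P (snd w) a)))))"
      by (simp add: w map_bind_pmf pmf.map_comp o_def) (simp add: map_pmf_def)
  qed
  then show ?thesis by (simp add: step_pmf_def bind_map_pmf)
qed

lemma step_at_snoc:
  assumes "1 \<le> t" "t \<le> length h"
  shows "step_at t (h @ [(s, y, a)], s') = step_at t (h, s)"
  using assms by (auto simp: step_at_def state_at_def obs_at_def action_at_def nth_append)

text \<open>
  A step can be read off a trajectory that has just made it, and later extensions leave it unchanged.
\<close>

lemma map_step_at:
  assumes "n < m"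
  shows "map_pmf (step_at (Suc n)) (trajectory_pmf P d m) = step_pmf P d n"
  using Suc_leI[OF assms]
proof (induction m rule: dec_induct)
  case base
  show ?case by (rule map_step_at_last)
next
  case (step m)
  have "map_pmf (step_at (Suc n)) (trajectory_pmf P d (Suc m)) =
      trajectory_pmf P d m \<bind> (\<lambda>w. return_pmf (step_at (Suc n) w))"
    unfolding trajectory_pmf.simps map_bind_pmf
  proof (rule bind_pmf_cong[OF refl])
    fix w assume "w \<in> set_pmf (trajectory_pmf P d m)"
    moreover obtain h s where "w = (h, s)" by force
    ultimately have w: "w = (h, s)" "length h = m" using length_trajectory by fastforce+
    show "map_pmf (step_at (Suc n)) (case w of (h, s) \<Rightarrow> emission P s \<bind> (\<lambda>y.
        embed_pmf (\<lambda>a. d (Suc m) a y) \<bind> (\<lambda>a. transition P s a \<bind>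
          (\<lambda>s'. return_pmf (h @ [(s, y, a)], s'))))) = return_pmf (step_at (Suc n) w)"
      using step.hyps w by (simp add: map_bind_pmf step_at_snoc)
  qed
  then show ?case using step.IH by (simp add: map_pmf_def)
qed

lemma pmf_bind_map_Pair: "pmf (p \<bind> (\<lambda>x. map_pmf (Pair x) (q x))) (x, y) = pmf p x * pmf (q x) y"
proof -
  have *: "pmf (map_pmf (Pair x') (q x')) (x, y) = (if x' = x then pmf (q x) y else 0)" for x'
  proof (cases "x' = x")
    case True
    then show ?thesis using pmf_map_inj'[of "Pair x" "q x" y] by (simp add: inj_on_def)
  next
    case False
    then show ?thesis by (auto simp: pmf_eq_0_set_pmf)
  qed
  show ?thesis
    by (subst pmf_bind, subst integral_measure_pmf[of "{x}"]) (auto simp: * split: if_splits)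
qed

lemma pmf_policy_row:
  assumes "d \<in> policies P" "t \<in> {1..horizon P}"
  shows "pmf (embed_pmf (\<lambda>a. d t a y)) a = d t a y"
  using assms
  by (intro pmf_embed_pmf) (auto simp: policies_def nn_integral_count_space_finite sum_ennreal)

section \<open>Marginals of the law as a forward recursion\<close>

text \<open>
  For times \<open>t \<ge> 1\<close>: the state at time \<open>t\<close> is the last component of a trajectory with \<open>t - 1\<close>
  steps. This form also covers the time after the last step.
\<close>

definition state_prob :: "('s, 'o, 'a) pomdp \<Rightarrow> ('o, 'a) policy \<Rightarrow> nat \<Rightarrow> 's \<Rightarrow> real" where
  "state_prob P d t s = pmf (map_pmf snd (trajectory_pmf P d (t - 1))) s"

text \<open>
  When \<open>d\<close> is a policy and \<open>t\<close> lies within the horizon, this is the probability of state, observation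
  and action \<open>(s, y, a)\<close> at time \<open>t\<close>, as the lemma \<open>prob_joint\<close> shows.
\<close>

definition joint_prob ::
  "('s, 'o, 'a) pomdp \<Rightarrow> ('o, 'a) policy \<Rightarrow> nat \<Rightarrow> 's \<Rightarrow> 'o \<Rightarrow> 'a \<Rightarrow> real" where
  "joint_prob P d t s y a = pmf (emission P s) y * state_prob P d t s * d t a y"

lemma state_prob_bounds: "0 \<le> state_prob P d t s" "state_prob P d t s \<le> 1"
  by (simp_all add: state_prob_def pmf_le_1)

lemma state_prob_first: "state_prob P d (Suc 0) s = pmf (init_prob P) s"
  by (simp add: state_prob_def pmf.map_comp o_def)

lemma pmf_step_pmf:
  assumes "d \<in> policies P" "n < horizon P"
  shows "pmf (step_pmf P d n) (s, y, a, s') =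
    pmf (transition P s a) s' * joint_prob P d (Suc n) s y a"
  using assms unfolding step_pmf_def pmf_bind_map_Pair joint_prob_def state_prob_def
  by (simp add: pmf_policy_row)

lemma sum_UNIV_prod:
  fixes f :: "'b::finite \<times> 'c::finite \<Rightarrow> 'd::comm_monoid_add"
  shows "sum f UNIV = (\<Sum>x\<in>UNIV. \<Sum>y\<in>UNIV. f (x, y))"
  by (simp add: sum.cartesian_product)

lemma prob_eq_sum_UNIV:
  fixes p :: "'b::finite pmf"
  shows "measure_pmf.prob p {z. Q z} = (\<Sum>z\<in>UNIV. if Q z then pmf p z else 0)"
  by (subst measure_measure_pmf_finite) (auto simp: sum.If_cases)

lemma sum_pmf_UNIV [simp]:
  fixes p :: "'b::finite pmf"
  shows "(\<Sum>x\<in>UNIV. pmf p x) = 1"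
  using sum_pmf_eq_1[of UNIV p] by simp

lemma prob_step_at:
  assumes "n < horizon P"
  shows "measure_pmf.prob (law P d) {w. Q (step_at (Suc n) w)} = measure_pmf.prob (step_pmf P d n) {z. Q z}"
  unfolding law_def map_step_at[OF assms, symmetric] by (simp add: vimage_def)

lemma prob_joint:
  fixes P :: "('s::finite, 'o::finite, 'a::finite) pomdp"
  assumes "d \<in> policies P" "t \<in> {1..horizon P}"
  shows "measure_pmf.prob (law P d) {w. state_at t w = s \<and> obs_at t w = y \<and> action_at t w = a} =
    joint_prob P d t s y a"
proof -
  obtain n where t: "t = Suc n" "n < horizon P" using assms(2) by (cases t) auto
  have "measure_pmf.prob (law P d) {w. state_at t w = s \<and> obs_at t w = y \<and> action_at t w = a} =
      measure_pmf.prob (step_pmf P d n) {(s\<^sub>0, y\<^sub>0, a\<^sub>0, s'). s\<^sub>0 = s \<and> y\<^sub>0 = y \<and> a\<^sub>0 = a}"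
    using prob_step_at[OF t(2), of d "\<lambda>(s\<^sub>0, y\<^sub>0, a\<^sub>0, s'). s\<^sub>0 = s \<and> y\<^sub>0 = y \<and> a\<^sub>0 = a"]
    by (simp add: step_at_def t)
  also have "{(s\<^sub>0, y\<^sub>0, a\<^sub>0, s' :: 's). s\<^sub>0 = s \<and> y\<^sub>0 = y \<and> a\<^sub>0 = a} = (\<lambda>s'. (s, y, a, s')) ` UNIV"
    by auto
  also have "measure_pmf.prob (step_pmf P d n) \<dots> = (\<Sum>s'\<in>UNIV. pmf (step_pmf P d n) (s, y, a, s'))"
    by (subst measure_measure_pmf_finite) (auto simp: sum.reindex inj_on_def)
  also have "\<dots> = joint_prob P d t s y a"
    using assms(1) t by (simp add: pmf_step_pmf flip: sum_distrib_right)
  finally show ?thesis .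
qed

lemma prob_state:
  assumes "t \<in> {1..horizon P}"
  shows "measure_pmf.prob (law P d) {w. state_at t w = s} = state_prob P d t s"
proof -
  obtain n where t: "t = Suc n" "n < horizon P" using assms by (cases t) auto
  have "measure_pmf.prob (law P d) {w. state_at t w = s} = measure_pmf.prob (step_pmf P d n) {z. fst z = s}"
    using prob_step_at[OF t(2), of d "\<lambda>z. fst z = s"] by (simp add: step_at_def t)
  also have "\<dots> = pmf (map_pmf fst (step_pmf P d n)) s"
    by (simp add: pmf_map vimage_def)
  also have "map_pmf fst (step_pmf P d n) = map_pmf snd (trajectory_pmf P d n)"
    by (simp add: step_pmf_def map_bind_pmf pmf.map_comp o_def map_pmf_const bind_return_pmf')
  finally show ?thesis by (simp add: state_prob_def t)
qed

lemma prob_state_action: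
  fixes P :: "('s::finite, 'o::finite, 'a::finite) pomdp"
  assumes "d \<in> policies P" "t \<in> {1..horizon P}"
  shows "measure_pmf.prob (law P d) {w. state_at t w = s \<and> action_at t w = a} =
    (\<Sum>y\<in>UNIV. joint_prob P d t s y a)"
proof -
  let ?E = "\<lambda>y. {w. state_at t w = s \<and> obs_at t w = y \<and> action_at t w = a}"
  have "{w. state_at t w = s \<and> action_at t w = a} = (\<Union>y\<in>UNIV. ?E y)"
    by auto
  then have "measure_pmf.prob (law P d) {w. state_at t w = s \<and> action_at t w = a} =
      measure_pmf.prob (law P d) (\<Union>y\<in>UNIV. ?E y)"
    by (rule arg_cong)
  also have "\<dots> = (\<Sum>y\<in>UNIV. measure_pmf.prob (law P d) (?E y))"
    by (rule measure_pmf.finite_measure_finite_Union) (auto simp: disjoint_family_on_def)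
  also have "\<dots> = (\<Sum>y\<in>UNIV. joint_prob P d t s y a)"
    by (simp only: prob_joint[OF assms])
  finally show ?thesis .
qed

text \<open>
  Conditioning on the step at time \<open>t\<close>. This is the flow constraint of the MILP with the marginals
  of the law in place of the variables.
\<close>

lemma state_prob_Suc:
  fixes P :: "('s::finite, 'o::finite, 'a::finite) pomdp"
  assumes "d \<in> policies P" "t \<in> {1..horizon P}"
  shows "state_prob P d (t + 1) s' =
    (\<Sum>s\<in>UNIV. \<Sum>a\<in>UNIV. pmf (transition P s a) s' * (\<Sum>y\<in>UNIV. joint_prob P d t s y a))"
proof -
  obtain n where t: "t = Suc n" "n < horizon P" using assms(2) by (cases t) auto
  have "map_pmf (\<lambda>z. snd (snd (snd z))) (step_pmf P d n) = map_pmf snd (trajectory_pmf P d t)"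
    unfolding t map_step_at_last[symmetric] pmf.map_comp
    by (rule map_pmf_cong) (auto simp: step_at_def state_at_def dest!: length_trajectory)
  then have "state_prob P d (t + 1) s' = pmf (map_pmf (\<lambda>z. snd (snd (snd z))) (step_pmf P d n)) s'"
    by (simp add: state_prob_def)
  also have "\<dots> = (\<Sum>z\<in>UNIV. if snd (snd (snd z)) = s' then pmf (step_pmf P d n) z else 0)"
    by (simp add: pmf_map vimage_def prob_eq_sum_UNIV)
  also have "\<dots> = (\<Sum>s\<in>UNIV. \<Sum>y\<in>UNIV. \<Sum>a\<in>UNIV. pmf (step_pmf P d n) (s, y, a, s'))"
    by (simp add: sum_UNIV_prod)
  also have "\<dots> = (\<Sum>s\<in>UNIV. \<Sum>a\<in>UNIV. \<Sum>y\<in>UNIV. pmf (transition P s a) s' * joint_prob P d t s y a)"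
    using assms(1) t by (subst (2) sum.swap) (simp add: pmf_step_pmf)
  finally show ?thesis by (simp add: sum_distrib_left)
qed

text \<open>
  By linearity of expectation the value is a function of the one-step marginals, and it is the one
  that the MILP maximizes.
\<close>

lemma policy_value_eq:
  fixes P :: "('s::finite, 'o::finite, 'a::finite) pomdp"
  assumes "d \<in> policies P"
  shows "policy_value P d = (\<Sum>t=1..horizon P. \<Sum>s\<in>UNIV. \<Sum>s'\<in>UNIV. \<Sum>a\<in>UNIV.
    reward P s a s' * pmf (transition P s a) s' * (\<Sum>y\<in>UNIV. joint_prob P d t s y a))"
proof -
  have "policy_value P d = (\<Sum>t=1..horizon P. measure_pmf.expectation (law P d)
      (\<lambda>w. reward P (state_at t w) (action_at t w) (state_at (t + 1) w)))"
    unfolding policy_value_def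
    by (rule Bochner_Integration.integral_sum, rule integrable_measure_pmf_finite)
       (simp add: law_def finite_set_trajectory_pmf)
  also have "\<dots> = (\<Sum>t=1..horizon P. \<Sum>s\<in>UNIV. \<Sum>s'\<in>UNIV. \<Sum>a\<in>UNIV.
    reward P s a s' * pmf (transition P s a) s' * (\<Sum>y\<in>UNIV. joint_prob P d t s y a))"
  proof (rule sum.cong[OF refl])
    fix t assume "t \<in> {1..horizon P}"
    then obtain n where t: "t = Suc n" "n < horizon P" by (cases t) auto
    have "measure_pmf.expectation (law P d)
        (\<lambda>w. reward P (state_at t w) (action_at t w) (state_at (t + 1) w)) =
        measure_pmf.expectation (step_pmf P d n) (\<lambda>(s, y, a, s'). reward P s a s')"
      unfolding law_def map_step_at[OF t(2), symmetric] by (simp add: step_at_def t)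
    also have "\<dots> = (\<Sum>s\<in>UNIV. \<Sum>y\<in>UNIV. \<Sum>a\<in>UNIV. \<Sum>s'\<in>UNIV.
        reward P s a s' * pmf (transition P s a) s' * joint_prob P d t s y a)"
      by (subst integral_measure_pmf[of UNIV])
         (use assms t in \<open>simp_all add: sum_UNIV_prod pmf_step_pmf mult_ac\<close>)
    also have "\<dots> = (\<Sum>s\<in>UNIV. \<Sum>s'\<in>UNIV. \<Sum>a\<in>UNIV. \<Sum>y\<in>UNIV.
        reward P s a s' * pmf (transition P s a) s' * joint_prob P d t s y a)"
    proof (rule sum.cong[OF refl])
      fix s
      let ?f = "\<lambda>y a s'. reward P s a s' * pmf (transition P s a) s' * joint_prob P d t s y a"
      have "(\<Sum>y\<in>UNIV. \<Sum>a\<in>UNIV. \<Sum>s'\<in>UNIV. ?f y a s') = (\<Sum>y\<in>UNIV. \<Sum>s'\<in>UNIV. \<Sum>a\<in>UNIV. ?f y a s')"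
        by (intro sum.cong refl) (rule sum.swap)
      also have "\<dots> = (\<Sum>s'\<in>UNIV. \<Sum>y\<in>UNIV. \<Sum>a\<in>UNIV. ?f y a s')"
        by (rule sum.swap)
      also have "\<dots> = (\<Sum>s'\<in>UNIV. \<Sum>a\<in>UNIV. \<Sum>y\<in>UNIV. ?f y a s')"
        by (intro sum.cong refl) (rule sum.swap)
      finally show "(\<Sum>y\<in>UNIV. \<Sum>a\<in>UNIV. \<Sum>s'\<in>UNIV. ?f y a s') = (\<Sum>s'\<in>UNIV. \<Sum>a\<in>UNIV. \<Sum>y\<in>UNIV. ?f y a s')" .
    qed
    finally show "measure_pmf.expectation (law P d)
        (\<lambda>w. reward P (state_at t w) (action_at t w) (state_at (t + 1) w)) =
        (\<Sum>s\<in>UNIV. \<Sum>s'\<in>UNIV. \<Sum>a\<in>UNIV.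
          reward P s a s' * pmf (transition P s a) s' * (\<Sum>y\<in>UNIV. joint_prob P d t s y a))"
      by (simp add: sum_distrib_left)
  qed
  finally show ?thesis .
qed

section \<open>Feasible points of the MILP are laws of deterministic policies\<close>

lemma det_policies_subset: "det_policies P \<subseteq> policies P"
  by (auto simp: det_policies_def)

text \<open>
  Linear bounds on a product are exact when one factor is binary. If \<open>d t a y = 0\<close>, then nonnegativity
  and the bound by \<open>d t a y\<close> force the value \<open>0\<close>; if \<open>d t a y = 1\<close>, then the bounds in terms of
  \<open>p(y|s)\<close> coincide.
\<close>

lemma milp_feasible_joint:
  assumes "((mS, mSA, mSOA), d) \<in> milp_feasible P" "t \<in> {1..horizon P}"
  shows "mSOA t s y a = pmf (emission P s) y * mS t s * d t a y"
proof -
  have d: "d t a y = 0 \<or> d t a y = 1"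
    using assms by (auto simp: milp_feasible_def det_policies_def)
  have "0 \<le> mSOA t s y a" "mSOA t s y a \<le> d t a y" "mSOA t s y a \<le> pmf (emission P s) y * mS t s"
    "pmf (emission P s) y * (mS t s + d t a y - 1) \<le> mSOA t s y a"
    using assms by (auto simp: milp_feasible_def)
  with d show ?thesis by auto
qed

text \<open>
  With the joint moments determined by the state moments, the flow constraint determines the state
  moments at time \<open>t + 1\<close> from those at time \<open>t\<close>, and the law obeys the same recursion.
\<close>

lemma milp_feasible_unique:
  assumes "((mS, mSA, mSOA), d) \<in> milp_feasible P" "t \<in> {1..horizon P}"
  shows "mS t s = state_prob P d t s"
    and "mSA t s a = (\<Sum>y\<in>UNIV. joint_prob P d t s y a)"
    and "mSOA t s y a = joint_prob P d t s y a"
proof -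
  have d: "d \<in> policies P"
    using assms(1) det_policies_subset by (auto simp: milp_feasible_def)
  have mSA: "mSA t s a = (\<Sum>y\<in>UNIV. mSOA t s y a)" if "t \<in> {1..horizon P}" for t s a
    using assms(1) that by (auto simp: milp_feasible_def)
  have "t \<le> horizon P \<longrightarrow> (\<forall>s. mS t s = state_prob P d t s)" if "1 \<le> t"
    using that
  proof (induction t rule: dec_induct)
    case base
    show ?case using assms(1) by (simp add: milp_feasible_def state_prob_first)
  next
    case (step t)
    show ?case
    proof (intro impI allI)
      fix s'
      assume "Suc t \<le> horizon P"
      with step.hyps have t: "t \<in> {1..horizon P}" by simp
      have "mSOA t s y a = joint_prob P d t s y a" for s y a
        using milp_feasible_joint[OF assms(1) t] step.IH t by (simp add: joint_prob_def)
      moreover have "mS (t + 1) s' = (\<Sum>s\<in>UNIV. \<Sum>a\<in>UNIV. pmf (transition P s a) s' * mSA t s a)"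
        using assms(1) t by (simp add: milp_feasible_def)
      ultimately show "mS (Suc t) s' = state_prob P d (Suc t) s'"
        using state_prob_Suc[OF d t, of s'] by (simp add: mSA[OF t])
    qed
  qed
  then show mS: "mS t s = state_prob P d t s" for s using assms(2) by simp
  show "mSOA t s y a = joint_prob P d t s y a" for y
    using milp_feasible_joint[OF assms] mS by (simp add: joint_prob_def)
  then show "mSA t s a = (\<Sum>y\<in>UNIV. joint_prob P d t s y a)"
    by (simp add: mSA[OF assms(2)])
qed

lemma milp_objective_eq_policy_value:
  assumes "((mS, mSA, mSOA), d) \<in> milp_feasible P"
  shows "milp_objective P ((mS, mSA, mSOA), d) = policy_value P d"
proof -
  have "d \<in> policies P"
    using assms det_policies_subset by (auto simp: milp_feasible_def)
  from policy_value_eq[OF this] show ?thesis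
    by (simp add: milp_objective_def milp_feasible_unique(2)[OF assms])
qed

lemma milp_feasible_induced:
  fixes P :: "('s::finite, 'o::finite, 'a::finite) pomdp"
  assumes "d \<in> det_policies P"
  shows "((state_prob P d, \<lambda>t s a. \<Sum>y\<in>UNIV. joint_prob P d t s y a, joint_prob P d), d)
    \<in> milp_feasible P"
proof -
  have d: "d \<in> policies P" using assms det_policies_subset by blast
  have bounds: "0 \<le> joint_prob P d t s y a" "joint_prob P d t s y a \<le> d t a y"
      "joint_prob P d t s y a \<le> pmf (emission P s) y * state_prob P d t s"
      "pmf (emission P s) y * (state_prob P d t s + d t a y - 1) \<le> joint_prob P d t s y a"
    if "t \<in> {1..horizon P}" for t s y a
  proof -
    have "d t a y = 0 \<or> d t a y = 1"
      using assms that by (auto simp: det_policies_def)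
    then show "0 \<le> joint_prob P d t s y a" "joint_prob P d t s y a \<le> d t a y"
      "joint_prob P d t s y a \<le> pmf (emission P s) y * state_prob P d t s"
      "pmf (emission P s) y * (state_prob P d t s + d t a y - 1) \<le> joint_prob P d t s y a"
      using state_prob_bounds[of P d t s]
      by (auto simp: joint_prob_def pmf_le_1 mult_le_one mult_le_0_iff)
  qed
  then show ?thesis
    using assms state_prob_Suc[OF d]
    by (simp add: milp_feasible_def state_prob_first state_prob_bounds sum_nonneg)
qed

section \<open>Deterministic policies suffice\<close>

definition fix_action :: "nat \<Rightarrow> 'o \<Rightarrow> 'a \<Rightarrow> ('o, 'a) policy \<Rightarrow> ('o, 'a) policy" where
  "fix_action t y a d = d(t := (\<lambda>b z. if z = y then of_bool (b = a) else d t b z))"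

lemma embed_pmf_point: "embed_pmf (\<lambda>b. of_bool (b = a)) = return_pmf a"
proof -
  have "pmf (return_pmf a) = (\<lambda>b. of_bool (b = a))"
    by (auto simp: fun_eq_iff)
  then show ?thesis
    by (metis type_definition.Rep_inverse[OF td_pmf_embed_pmf])
qed

text \<open>
  Drawing the action for observation \<open>y\<close> at time \<open>t\<close> ahead of the process does not change the law,
  because this draw is used at most once. Before time \<open>t\<close> the draw has no influence, after time \<open>t\<close>
  it has already been made, and at time \<open>t\<close> it can be moved past the independent draws of the past
  and of the observation to the place where the policy makes it. In other words, the law
  is a mixture of the laws of the policies with a fixed action in this row.
\<close>

lemma trajectory_pmf_randomise_first:
  fixes P :: "('s, 'o, 'a) pomdp"
  shows "trajectory_pmf P d n =
     embed_pmf (\<lambda>a. d t a y) \<bind> (\<lambda>a. trajectory_pmf P (fix_action t y a d) n)"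
proof (induction n)
  case 0
  show ?case by simp
next
  case (Suc n)
  let ?row = "embed_pmf (\<lambda>a. d t a y)"
  let ?k = "\<lambda>d' w. case w of (h, s) \<Rightarrow> emission P s \<bind> (\<lambda>z. embed_pmf (\<lambda>a. d' (Suc n) a z) \<bind>
      (\<lambda>a. transition P s a \<bind> (\<lambda>s'. return_pmf (h @ [(s, z, a)], s'))))"
  show ?case
  proof (cases "Suc n = t")
    case False
    then have "?k (fix_action t y a d) = ?k d" for a
      by (simp add: fix_action_def)
    then have "trajectory_pmf P (fix_action t y a d) (Suc n) =
        trajectory_pmf P (fix_action t y a d) n \<bind> ?k d" for a
      by simp
    moreover have "trajectory_pmf P d (Suc n) = trajectory_pmf P d n \<bind> ?k d" by simp
    ultimately show ?thesis by (simp only: Suc.IH bind_assoc_pmf)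
  next
    case True
    \<comment> \<open>Only for observation \<open>y\<close> does the early draw decide the action; otherwise it is discarded.\<close>
    have row: "?row \<bind> (\<lambda>b. embed_pmf (\<lambda>a. fix_action t y b d t a z) \<bind> c) =
        embed_pmf (\<lambda>a. d t a z) \<bind> c" for z and c :: "'a \<Rightarrow> ('s, 'o, 'a) trajectory pmf"
      by (cases "z = y") (simp_all add: fix_action_def embed_pmf_point bind_return_pmf)
    have past: "trajectory_pmf P (fix_action t y b d) n = trajectory_pmf P d n" for b
      using True by (intro trajectory_pmf_cong) (auto simp: fix_action_def)
    have step: "?row \<bind> (\<lambda>b. ?k (fix_action t y b d) w) = ?k d w" for w
    proof -
      obtain h s where w: "w = (h, s)" by force
      show ?thesis
        unfolding w prod.case True
        by (subst bind_commute_pmf) (simp only: row)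
    qed
    have "?row \<bind> (\<lambda>b. trajectory_pmf P (fix_action t y b d) (Suc n)) =
        ?row \<bind> (\<lambda>b. trajectory_pmf P d n \<bind> ?k (fix_action t y b d))"
      by (simp only: trajectory_pmf.simps past)
    also have "\<dots> = trajectory_pmf P d n \<bind> (\<lambda>w. ?row \<bind> (\<lambda>b. ?k (fix_action t y b d) w))"
      by (rule bind_commute_pmf)
    also have "\<dots> = trajectory_pmf P d (Suc n)"
      by (simp only: step trajectory_pmf.simps)
    finally show ?thesis by simp
  qed
qed

lemma fix_action_policies:
  assumes "d \<in> policies P"
  shows "fix_action t y a d \<in> policies P"
proof -
  have "(\<Sum>b\<in>UNIV. fix_action t y a d u b z) =
      (if u = t \<and> z = y then 1 else \<Sum>b\<in>UNIV. d u b z)" for u z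
    by (cases "u = t"; cases "z = y") (simp_all add: fix_action_def of_bool_def)
  moreover have "0 \<le> fix_action t y a d u b z" if "0 \<le> d u b z" for u b z
    using that by (auto simp: fix_action_def)
  ultimately show ?thesis using assms by (simp add: policies_def)
qed

text \<open>
  The value of the policy is an average of the values of the policies with a fixed action, so they
  cannot all be smaller.
\<close>

lemma ex_fix_action_ge:
  fixes P :: "('s::finite, 'o::finite, 'a::finite) pomdp"
  shows "\<exists>a. policy_value P d \<le> policy_value P (fix_action t y a d)"
proof (rule ccontr)
  assume "\<not> ?thesis"
  then have less: "policy_value P (fix_action t y a d) < policy_value P d" for a
    by (simp add: not_le)
  let ?row = "embed_pmf (\<lambda>a. d t a y)"
  have "policy_value P d = (\<Sum>a\<in>UNIV. pmf ?row a * policy_value P (fix_action t y a d))"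
    unfolding policy_value_def law_def
    by (subst trajectory_pmf_randomise_first[of P d _ t y], subst pmf_expectation_bind[of UNIV])
       (simp_all add: finite_set_trajectory_pmf)
  also have "\<dots> < (\<Sum>a\<in>UNIV. pmf ?row a * policy_value P d)"
  proof (rule sum_strict_mono_ex1)
    obtain a where "a \<in> set_pmf ?row" using set_pmf_not_empty by fast
    then have "pmf ?row a * policy_value P (fix_action t y a d) < pmf ?row a * policy_value P d"
      using less by (intro mult_strict_left_mono pmf_positive)
    then show "\<exists>a\<in>UNIV. pmf ?row a * policy_value P (fix_action t y a d) < pmf ?row a * policy_value P d"
      by blast
  qed (auto intro!: mult_left_mono less_imp_le[OF less])
  also have "\<dots> = policy_value P d"
    by (simp flip: sum_distrib_right)
  finally show False by simp
qed

text \<open>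
  Rows are made deterministic one at a time; fixing the action in one row keeps the rows that were
  treated before.
\<close>

lemma ex_det_policy_ge:
  fixes P :: "('s::finite, 'o::finite, 'a::finite) pomdp"
  assumes "d \<in> policies P"
  shows "\<exists>d'\<in>det_policies P. policy_value P d \<le> policy_value P d'"
proof -
  have "\<exists>d'\<in>policies P. policy_value P d \<le> policy_value P d' \<and> (\<forall>(t, y)\<in>R. \<forall>a. d' t a y \<in> {0, 1})"
    if "finite R" for R
    using that
  proof (induction R)
    case empty
    show ?case using assms by auto
  next
    case (insert r R)
    obtain t\<^sub>0 y\<^sub>0 where r: "r = (t\<^sub>0, y\<^sub>0)" by force
    obtain d' where d': "d' \<in> policies P" "policy_value P d \<le> policy_value P d'"
        "\<forall>(t, y)\<in>R. \<forall>a. d' t a y \<in> {0, 1}"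
      using insert.IH by blast
    obtain a where "policy_value P d' \<le> policy_value P (fix_action t\<^sub>0 y\<^sub>0 a d')"
      using ex_fix_action_ge by blast
    with d'(2) have "policy_value P d \<le> policy_value P (fix_action t\<^sub>0 y\<^sub>0 a d')"
      by simp
    moreover have "\<forall>(t, y)\<in>insert r R. \<forall>b. fix_action t\<^sub>0 y\<^sub>0 a d' t b y \<in> {0, 1}"
      using d'(3) by (fastforce simp: r fix_action_def)
    ultimately show ?case
      using fix_action_policies[OF d'(1)] by blast
  qed
  from this[of "{1..horizon P} \<times> UNIV"] show ?thesis
    by (fastforce simp: det_policies_def)
qed

text \<open>
  The policies themselves may take arbitrary values outside the horizon, so there can be infinitely
  many deterministic ones. The value sees only the part within the horizon, for which there are
  finitely many possibilities.
\<close>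

lemma finite_det_policy_values:
  fixes P :: "('s::finite, 'o::finite, 'a::finite) pomdp"
  shows "finite (policy_value P ` det_policies P)"
proof -
  let ?T = "{1..horizon P}"
  let ?restrict = "\<lambda>d t. if t \<in> ?T then d t else (\<lambda>_ _. 0)"
  let ?rows = "{h :: 'o \<Rightarrow> real. \<forall>y. (y \<in> UNIV \<longrightarrow> h y \<in> {0, 1}) \<and> (y \<notin> UNIV \<longrightarrow> h y = 0)}"
  let ?rules = "{g :: 'a \<Rightarrow> 'o \<Rightarrow> real. \<forall>a. (a \<in> UNIV \<longrightarrow> g a \<in> ?rows) \<and> (a \<notin> UNIV \<longrightarrow> g a = (\<lambda>_. 0))}"
  let ?D = "{f. \<forall>t. (t \<in> ?T \<longrightarrow> f t \<in> ?rules) \<and> (t \<notin> ?T \<longrightarrow> f t = (\<lambda>_ _. 0))}"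
  have "finite ?D"
    by (intro finite_set_of_finite_funs) auto
  moreover have "policy_value P ` det_policies P \<subseteq> policy_value P ` ?D"
  proof
    fix v assume "v \<in> policy_value P ` det_policies P"
    then obtain d where d: "d \<in> det_policies P" "v = policy_value P d" by blast
    have "law P d = law P (?restrict d)"
      unfolding law_def by (rule trajectory_pmf_cong) simp
    then have "v = policy_value P (?restrict d)" by (simp add: d policy_value_def)
    moreover have "?restrict d \<in> ?D" using d(1) by (auto simp: det_policies_def)
    ultimately show "v \<in> policy_value P ` ?D" by blast
  qed
  ultimately show ?thesis using finite_surj by blast
qed

lemma det_policies_nonempty: "det_policies P \<noteq> {}"
proof -
  have "(\<lambda>t a y. of_bool (a = undefined)) \<in> det_policies P"
    by (auto simp: det_policies_def policies_def)
  then show ?thesis by blast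
qed

lemma ex_optimal_det_policy:
  fixes P :: "('s::finite, 'o::finite, 'a::finite) pomdp"
  obtains d where "d \<in> det_policies P" "\<And>d'. d' \<in> policies P \<Longrightarrow> policy_value P d' \<le> policy_value P d"
proof -
  let ?V = "policy_value P ` det_policies P"
  have "Max ?V \<in> ?V"
    by (simp add: finite_det_policy_values det_policies_nonempty)
  then obtain d where d: "d \<in> det_policies P" "policy_value P d = Max ?V" by auto
  moreover have "policy_value P d' \<le> policy_value P d" if d': "d' \<in> policies P" for d'
  proof -
    obtain e where "e \<in> det_policies P" "policy_value P d' \<le> policy_value P e"
      using ex_det_policy_ge[OF d'] by blast
    then show ?thesis
      using Max_ge[OF finite_det_policy_values[of P], of "policy_value P e"] d(2) by fastforce
  qed
  ultimately show ?thesis using that by blast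
qed

section \<open>Equivalence of the two problems\<close>

theorem theorem1:
  fixes P :: "('s::finite, 'o::finite, 'a::finite) pomdp"
  shows "(\<forall>mS mSA mSOA d. ((mS, mSA, mSOA), d) \<in> milp_feasible P \<longrightarrow>
      (\<forall>s y a. \<forall>t\<in>{1..horizon P}.
         mS t s = measure_pmf.prob (law P d) {w. state_at t w = s} \<and>
         mSA t s a = measure_pmf.prob (law P d) {w. state_at t w = s \<and> action_at t w = a} \<and>
         mSOA t s y a = measure_pmf.prob (law P d)
           {w. state_at t w = s \<and> obs_at t w = y \<and> action_at t w = a}) \<and>
      (is_arg_max (milp_objective P) (\<lambda>x. x \<in> milp_feasible P) ((mS, mSA, mSOA), d) \<longleftrightarrow>
         d \<in> det_policies P \<and> ereal (policy_value P d) = v_star P)) \<and>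
    (\<exists>d\<in>policies P. ereal (policy_value P d) = v_star P) \<and>
    (\<exists>x\<in>milp_feasible P. ereal (milp_objective P x) = z_star P) \<and>
    v_star P = z_star P"
proof -
  obtain d\<^sub>0 where d\<^sub>0: "d\<^sub>0 \<in> det_policies P"
      "\<And>d. d \<in> policies P \<Longrightarrow> policy_value P d \<le> policy_value P d\<^sub>0"
    using ex_optimal_det_policy[of P] by blast
  then have d\<^sub>0': "d\<^sub>0 \<in> policies P" using det_policies_subset by blast
  have v: "v_star P = ereal (policy_value P d\<^sub>0)"
    unfolding v_star_def using d\<^sub>0(2) d\<^sub>0' by (intro antisym SUP_least SUP_upper) auto
  \<comment> \<open>The MILP is the maximization of the value over deterministic policies, in disguise.\<close>
  have feas: "snd x \<in> det_policies P" "snd x \<in> policies P" "milp_objective P x = policy_value P (snd x)"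
    if "x \<in> milp_feasible P" for x
  proof -
    obtain mS mSA mSOA d where x: "x = ((mS, mSA, mSOA), d)" by (metis prod.collapse)
    show "snd x \<in> det_policies P" using that by (auto simp: x milp_feasible_def)
    then show "snd x \<in> policies P" using det_policies_subset by blast
    show "milp_objective P x = policy_value P (snd x)"
      using that milp_objective_eq_policy_value by (simp add: x)
  qed
  obtain x\<^sub>0 where x\<^sub>0: "x\<^sub>0 \<in> milp_feasible P" "milp_objective P x\<^sub>0 = policy_value P d\<^sub>0"
    using milp_feasible_induced[OF d\<^sub>0(1)] milp_objective_eq_policy_value by blast
  have z: "z_star P = ereal (policy_value P d\<^sub>0)"
    unfolding z_star_def
  proof (rule antisym)
    show "(SUP x\<in>milp_feasible P. ereal (milp_objective P x)) \<le> ereal (policy_value P d\<^sub>0)"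
      using feas d\<^sub>0(2) by (intro SUP_least) auto
    show "ereal (policy_value P d\<^sub>0) \<le> (SUP x\<in>milp_feasible P. ereal (milp_objective P x))"
      using x\<^sub>0 by (metis SUP_upper)
  qed
  have opt: "is_arg_max (milp_objective P) (\<lambda>x. x \<in> milp_feasible P) x \<longleftrightarrow>
      policy_value P (snd x) = policy_value P d\<^sub>0" if x: "x \<in> milp_feasible P" for x
  proof -
    have "milp_objective P y \<le> policy_value P d\<^sub>0" if "y \<in> milp_feasible P" for y
      using feas[OF that] d\<^sub>0(2) by simp
    then show ?thesis
      using x x\<^sub>0 feas(3)[OF x] unfolding is_arg_max_def by (metis linorder_not_less order_antisym_conv)
  qed
  show ?thesis
  proof (intro conjI allI impI ballI)
    fix mS mSA mSOA d s y a t
    assume x: "((mS, mSA, mSOA), d) \<in> milp_feasible P" and t: "t \<in> {1..horizon P}"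
    have d: "d \<in> policies P" using feas(2)[OF x] by simp
    show "mS t s = measure_pmf.prob (law P d) {w. state_at t w = s}"
      using milp_feasible_unique(1)[OF x t] prob_state[OF t] by metis
    show "mSA t s a = measure_pmf.prob (law P d) {w. state_at t w = s \<and> action_at t w = a}"
      using milp_feasible_unique(2)[OF x t] prob_state_action[OF d t] by metis
    show "mSOA t s y a = measure_pmf.prob (law P d)
        {w. state_at t w = s \<and> obs_at t w = y \<and> action_at t w = a}"
      using milp_feasible_unique(3)[OF x t] prob_joint[OF d t] by metis
  next
    fix mS mSA mSOA d
    assume x: "((mS, mSA, mSOA), d) \<in> milp_feasible P"
    then show "is_arg_max (milp_objective P) (\<lambda>x. x \<in> milp_feasible P) ((mS, mSA, mSOA), d) \<longleftrightarrow>
        d \<in> det_policies P \<and> ereal (policy_value P d) = v_star P"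
      using opt[OF x] feas(1)[OF x] by (simp add: v)
  next
    show "\<exists>d\<in>policies P. ereal (policy_value P d) = v_star P"
      using d\<^sub>0' v by auto
    show "\<exists>x\<in>milp_feasible P. ereal (milp_objective P x) = z_star P"
      using x\<^sub>0 z by auto
    show "v_star P = z_star P"
      by (simp add: v z)
  qed
qed

end
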